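(* Let $n\ge4$ be even and let $f=a_1x_1^2+\dots+a_nx_n^2$ with $a_i\in\mathbb{F}_q^\times$ such that $(-1)^{n/2}a_1\cdots a_n$ is not a square in $\mathbb{F}_q^\times$. Then for every integer $P\ge1$: if $n=4$, $$N(P)=\begin{cases}q^{2P}&\text{if }2\mid P,\\ \frac{q^2-q+1}{q}\,q^{2P}&\text{if }2\nmid P,\end{cases}$$ and if $n\ge6$, $$N(P)=\frac{q^{n/2}+1}{q^{n/2-1}+q}\,q^{P(n-2)}-(-1)^P(q-1)\frac{q^{n/2-1}-1}{q^{n/2-1}+q}\,q^{\frac n2P}.$$
   Context: $q$ is a power of an odd prime. $N(P)=\#\{\mathbf{x}\in\mathbb{F}_q[t]^n:\deg(x_i)<P\text{ for all }i,\ f(\mathbf{x})=0\}$ (with the convention $\deg 0=-\infty$, so $\mathbf{x}=\mathbf{0}$ is counted). *)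

theory Defs
  imports "HOL-Computational_Algebra.Polynomial" "HOL-Library.Cardinality"
begin

text \<open>The finite field F_q is a finite field type 'a with q = CARD('a).
  Vectors x in F_q[t]^n are functions nat => 'a poly, zero outside {0..<n}.
  The quadratic form is f(x) = sum_{i<n} a_i x_i^2 with coefficients a_i in F_q.
  deg 0 = -infinity, so x_i = 0 always satisfies the degree bound.\<close>

definition diag_form :: "nat \<Rightarrow> (nat \<Rightarrow> 'a::field) \<Rightarrow> (nat \<Rightarrow> 'a poly) \<Rightarrow> 'a poly" where
  "diag_form n a x = (\<Sum>i<n. smult (a i) (x i ^ 2))"

definition count_N :: "nat \<Rightarrow> (nat \<Rightarrow> 'a::{finite,field}) \<Rightarrow> nat \<Rightarrow> nat" where
  "count_N n a P = card {x :: nat \<Rightarrow> 'a poly.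
      (\<forall>i. n \<le> i \<longrightarrow> x i = 0) \<and>
      (\<forall>i<n. x i = 0 \<or> degree (x i) < P) \<and>
      diag_form n a x = 0}"

end

(* Call a function f to F_q biased with bias E if #f^-1(0) - #f^-1(c) = E for every nonzero c; this
   is the character sum of f without the characters, and it is multiplicative over orthogonal sums.
   A form of even rank n whose signed discriminant is a nonsquare has bias w = - q^(n/2).
   Evaluating the coefficients of f(x) against a linear functional alpha gives the tensor product
   of f with the P x P Hankel form of alpha. If the Hankel form has nullity k, diagonalizing it shows
   that this product has bias w^(P - k) * q^(n k) = w^(P + k), so N(P) q^(2 P - 1) is the sum of
   w^(P + k) over all alpha. The nullities are counted through the kernels K_b of the
   (2 P - b) x b Hankel matrices: K_(b+1) is zero or has exactly one more dimension than K_b, and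
   the average size of K_b is elementary because multiplication by a nonzero polynomial is
   injective. *)
theory Submission
  imports Defs
begin

section \<open>Bias\<close>

text \<open>A single sum over \<open>X\<close>, rather than a difference of two cardinalities, lets
  sums be interchanged later. Asking for the same \<open>E\<close> at every nonzero \<open>c\<close>
  makes the bias multiplicative and stable under scaling.\<close>

definition biased :: "'b set \<Rightarrow> ('b \<Rightarrow> 'a::zero) \<Rightarrow> int \<Rightarrow> bool" where
  "biased X f E \<longleftrightarrow> (\<forall>c. c \<noteq> 0 \<longrightarrow> (\<Sum>x\<in>X. of_bool (f x = 0) - of_bool (f x = c)) = E)"

lemma biasedI:
  assumes "\<And>c. c \<noteq> 0 \<Longrightarrow> (\<Sum>x\<in>X. of_bool (f x = 0) - of_bool (f x = c)) = E"
  shows "biased X f E"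
  using assms by (simp add: biased_def)

lemma biasedD:
  assumes "biased X f E" "c \<noteq> 0"
  shows "(\<Sum>x\<in>X. of_bool (f x = 0) - of_bool (f x = c)) = E"
  using assms by (simp add: biased_def)

lemma biased_cong:
  assumes "\<And>x. x \<in> X \<Longrightarrow> f x = g x"
  shows "biased X f E \<longleftrightarrow> biased X g E"
  unfolding biased_def using assms by (simp cong: sum.cong)

lemma biased_reindex:
  fixes f :: "'b \<Rightarrow> 'a::zero"
  assumes "bij_betw h X Y" "biased X (\<lambda>x. f (h x)) E"
  shows "biased Y f E"
proof (rule biasedI)
  fix c :: 'a assume c: "c \<noteq> 0"
  show "(\<Sum>x\<in>Y. of_bool (f x = 0) - of_bool (f x = c)) = E"
    using sum.reindex_bij_betw[OF assms(1), of "\<lambda>x. of_bool (f x = 0) - of_bool (f x = c) :: int"]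
      biasedD[OF assms(2) c] by simp
qed

lemma biased_scale:
  fixes f :: "'b \<Rightarrow> 'a::field"
  assumes "biased X f E" "k \<noteq> 0"
  shows "biased X (\<lambda>x. k * f x) E"
proof (rule biasedI)
  fix c :: 'a assume "c \<noteq> 0"
  then have "c / k \<noteq> 0" using assms(2) by simp
  have "k * f x = c \<longleftrightarrow> f x = c / k" for x
    using assms(2) by (auto simp: field_simps)
  then show "(\<Sum>x\<in>X. of_bool (k * f x = 0) - of_bool (k * f x = c)) = E"
    using biasedD[OF assms(1) \<open>c / k \<noteq> 0\<close>] assms(2) by simp
qed

lemma biased_zero: "biased X (\<lambda>x. 0) (int (card X))"
  by (rule biasedI) simp

text \<open>Two arbitrary values are compared because in an orthogonal sum the second summand shifts
  both values of the first.\<close>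

lemma biased_fibres:
  assumes "biased X f E"
  shows "(\<Sum>x\<in>X. of_bool (f x = s) - of_bool (f x = t)) = E * (of_bool (s = 0) - of_bool (t = 0))"
proof -
  have *: "(\<Sum>x\<in>X. of_bool (f x = 0) - of_bool (f x = c)) = E * (1 - of_bool (c = 0))" for c
    using biasedD[OF assms] by (cases "c = 0") auto
  have "(\<Sum>x\<in>X. of_bool (f x = s) - of_bool (f x = t) :: int) =
      (\<Sum>x\<in>X. (of_bool (f x = 0) - of_bool (f x = t)) - (of_bool (f x = 0) - of_bool (f x = s)))"
    by (rule sum.cong) auto
  also have "\<dots> = E * (1 - of_bool (t = 0)) - E * (1 - of_bool (s = 0))"
    by (simp only: sum_subtractf[of "\<lambda>x. of_bool (f x = 0) - of_bool (f x = t)"] *)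
  finally show ?thesis by (simp add: algebra_simps)
qed

text \<open>With \<open>y\<close> fixed, \<open>f\<close> is compared at \<open>- g y\<close> and
  \<open>c - g y\<close>, which gives \<open>E\<close> times the term of \<open>y\<close> in the
  bias of \<open>g\<close>.\<close>

lemma biased_sum:
  fixes f :: "'b \<Rightarrow> 'a::ab_group_add" and g :: "'c \<Rightarrow> 'a"
  assumes "biased X f E" "biased Y g D"
  shows "biased (X \<times> Y) (\<lambda>(x, y). f x + g y) (E * D)"
proof (rule biasedI)
  fix c :: 'a assume c: "c \<noteq> 0"
  have "(\<Sum>z\<in>X \<times> Y. of_bool ((\<lambda>(x, y). f x + g y) z = 0) - of_bool ((\<lambda>(x, y). f x + g y) z = c)) =
      (\<Sum>x\<in>X. \<Sum>y\<in>Y. of_bool (f x + g y = 0) - of_bool (f x + g y = c) :: int)"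
    by (simp add: sum.cartesian_product case_prod_unfold)
  also have "\<dots> = (\<Sum>y\<in>Y. \<Sum>x\<in>X. of_bool (f x = - g y) - of_bool (f x = c - g y))"
    by (subst sum.swap) (simp add: eq_neg_iff_add_eq_0 eq_diff_eq)
  also have "\<dots> = (\<Sum>y\<in>Y. E * (of_bool (g y = 0) - of_bool (g y = c)))"
    by (subst biased_fibres[OF assms(1)]) (auto intro!: sum.cong)
  also have "\<dots> = E * D"
    by (simp only: sum_distrib_left[symmetric] biasedD[OF assms(2) c])
  finally show "(\<Sum>z\<in>X \<times> Y. of_bool ((\<lambda>(x, y). f x + g y) z = 0) -
      of_bool ((\<lambda>(x, y). f x + g y) z = c)) = E * D" .
qed

section \<open>Quadratic forms of even rank\<close>

text \<open>Translation by 1 permutes the field, so adding 1 to every element leaves their sum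
  unchanged and \<open>CARD('a)\<close> vanishes in the field. Being odd, it would equal 1 if 2 were
  0.\<close>

lemma two_neq_0_if_odd_card:
  assumes "odd CARD('a::{finite,field})"
  shows "(2::'a) \<noteq> 0"
proof
  assume two: "(2::'a) = 0"
  have "bij (\<lambda>x::'a. x + 1)"
    by (rule bij_betw_byWitness[where f' = "\<lambda>x. x - 1"]) auto
  from sum.reindex_bij_betw[OF this, of "\<lambda>x. x"]
  have "of_nat CARD('a) = (0::'a)" by (simp add: sum.distrib)
  moreover obtain k where "CARD('a) = 2 * k + 1" using assms by (elim oddE)
  ultimately show False using two by simp
qed

section \<open>Squares and nonsquares in a finite field of odd order\<close>

definition is_sq :: "'a::field \<Rightarrow> bool" where
  "is_sq d \<longleftrightarrow> (\<exists>y. y ^ 2 = d)"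

text \<open>Squaring is at most two-to-one, so at least q/2 elements are squares; as q is odd, this
  improves to (q + 1)/2.\<close>

lemma card_squares:
  assumes "odd CARD('a::{finite,field})"
  shows "CARD('a) + 1 \<le> 2 * card (range (\<lambda>x::'a. x ^ 2))"
proof -
  have "CARD('a) = (\<Sum>s\<in>range (\<lambda>x::'a. x ^ 2). card {x::'a. x ^ 2 = s})"
    using sum.group[of "UNIV::'a set" "range (\<lambda>x::'a. x ^ 2)" "\<lambda>x. x ^ 2" "\<lambda>x. 1::nat"] by simp
  also have "\<dots> \<le> (\<Sum>s\<in>range (\<lambda>x::'a. x ^ 2). 2)"
  proof (rule sum_mono)
    fix s :: 'a assume "s \<in> range (\<lambda>x. x ^ 2)"
    then obtain y where "s = y ^ 2" by auto
    then have "{x. x ^ 2 = s} \<subseteq> {y, - y}" by (auto simp: power2_eq_iff)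
    then have "card {x. x ^ 2 = s} \<le> card {y, - y}" by (intro card_mono) auto
    also have "\<dots> \<le> 2" by (simp add: card_insert_if)
    finally show "card {x. x ^ 2 = s} \<le> 2" .
  qed
  finally have "CARD('a) \<le> 2 * card (range (\<lambda>x::'a. x ^ 2))" by simp
  moreover have "CARD('a) \<noteq> 2 * card (range (\<lambda>x::'a. x ^ 2))" using assms by (metis dvd_triv_left)
  ultimately show ?thesis by simp
qed

lemma card_scaled_squares:
  fixes c d :: "'a::{finite,field}"
  assumes "odd CARD('a)" "d \<noteq> 0"
  shows "CARD('a) + 1 \<le> 2 * card (range (\<lambda>x. c + d * x ^ 2))"
proof -
  have "inj (\<lambda>z. c + d * z)" using assms(2) by (auto intro: injI)
  then have "card ((\<lambda>z. c + d * z) ` range (\<lambda>x::'a. x ^ 2)) = card (range (\<lambda>x::'a. x ^ 2))"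
    by (intro card_image) (auto intro: inj_on_subset)
  moreover have "(\<lambda>z. c + d * z) ` range (\<lambda>x::'a. x ^ 2) = range (\<lambda>x. c + d * x ^ 2)" by auto
  ultimately show ?thesis using card_squares[OF assms(1)] by simp
qed

text \<open>The squares and their multiples by \<open>a\<close> share only 0, and each set has at
  least (q + 1)/2 elements, so together they exhaust the field. Hence the nonsquare \<open>b\<close>
  is \<open>a\<close> times a square.\<close>

lemma is_sq_mult_nonsq:
  fixes a b :: "'a::{finite,field}"
  assumes odd: "odd CARD('a)" and a: "\<not> is_sq a" and b: "\<not> is_sq b"
  shows "is_sq (a * b)"
proof -
  let ?S = "range (\<lambda>x::'a. x ^ 2)" and ?T = "range (\<lambda>x. 0 + a * x ^ 2)"
  have a0: "a \<noteq> 0" using a unfolding is_sq_def by (metis power_zero_numeral)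
  have "?S \<inter> ?T \<subseteq> {0}"
  proof
    fix z assume "z \<in> ?S \<inter> ?T"
    then obtain x y where xy: "z = x ^ 2" "z = a * y ^ 2" unfolding add_0 by blast
    show "z \<in> {0}"
    proof (rule ccontr)
      assume "z \<notin> {0}"
      then have "y \<noteq> 0" using xy by auto
      then have "(x / y) ^ 2 = a" using xy by (simp add: power_divide nonzero_divide_eq_eq)
      then show False using a unfolding is_sq_def by blast
    qed
  qed
  then have "card (?S \<inter> ?T) \<le> card {0::'a}" by (intro card_mono) auto
  then have "CARD('a) \<le> card (?S \<union> ?T)"
    using card_Un_Int[of ?S ?T] card_squares[OF odd] card_scaled_squares[OF odd a0, of 0] by simp
  then have "?S \<union> ?T = UNIV" by (intro card_seteq) auto
  then have "b \<in> ?S \<union> ?T" by simp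
  then obtain y where "b = a * y ^ 2" using b unfolding is_sq_def by auto
  then have "(a * y) ^ 2 = a * b" by (simp add: power2_eq_square)
  then show ?thesis unfolding is_sq_def by blast
qed

lemma is_sq_mult: "is_sq a \<Longrightarrow> is_sq b \<Longrightarrow> is_sq (a * b)"
  unfolding is_sq_def by (auto simp flip: power_mult_distrib)

lemma is_sq_cancel:
  assumes "is_sq (a * b)" "is_sq a" "a \<noteq> 0"
  shows "is_sq b"
proof -
  obtain x y where "x ^ 2 = a * b" "y ^ 2 = a" using assms by (auto simp: is_sq_def)
  then have "(x / y) ^ 2 = b" using assms(3) by (simp add: power_divide field_simps)
  then show ?thesis unfolding is_sq_def by blast
qed

lemma is_sq_mult_iff:
  fixes a b :: "'a::{finite,field}"
  assumes "odd CARD('a)" "a \<noteq> 0" "b \<noteq> 0"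
  shows "is_sq (a * b) \<longleftrightarrow> (is_sq a \<longleftrightarrow> is_sq b)"
  using is_sq_mult_nonsq[OF assms(1), of a b] is_sq_mult[of a b] is_sq_cancel[of a b]
    is_sq_cancel[of b a, unfolded mult.commute[of b a]] assms(2,3) by blast

section \<open>Binary quadratic forms\<close>

lemma biased_product:
  "biased UNIV (\<lambda>(u, v). u * v :: 'a::{finite,field}) (int CARD('a))"
proof (rule biasedI)
  fix c :: 'a assume c: "c \<noteq> 0"
  have "(\<Sum>v\<in>UNIV. of_bool (u * v = 0) - of_bool (u * v = c) :: int) =
      (if u = 0 then int CARD('a) else 0)" for u
  proof (cases "u = 0")
    case False
    then have "u * v = c \<longleftrightarrow> v = c / u" for v by (auto simp: field_simps)
    then show ?thesis using False by (simp add: sum_subtractf of_bool_def)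
  qed (use c in auto)
  then have "(\<Sum>u\<in>UNIV. \<Sum>v\<in>UNIV. of_bool (u * v = 0) - of_bool (u * v = c) :: int) = int CARD('a)"
    by simp
  then show "(\<Sum>x\<in>UNIV. of_bool ((\<lambda>(u, v). u * v) x = 0) - of_bool ((\<lambda>(u, v). u * v) x = c)) = int CARD('a)"
    by (simp add: sum.cartesian_product case_prod_unfold)
qed

text \<open>The factors \<open>x + e * y\<close> and \<open>x - e * y\<close> serve as new
  coordinates, in which the form is the product \<open>u * v\<close>.\<close>

lemma biased_norm_form_split:
  fixes e :: "'a::{finite,field}"
  assumes "odd CARD('a)" "e \<noteq> 0"
  shows "biased UNIV (\<lambda>(x, y). x ^ 2 - e ^ 2 * y ^ 2) (int CARD('a))"
proof (rule biased_reindex)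
  have two: "(2::'a) \<noteq> 0" by (rule two_neq_0_if_odd_card) fact
  then have "(4::'a) \<noteq> 0" using mult_eq_0_iff[of "2::'a" 2] by simp
  show "bij_betw (\<lambda>(u, v). ((u + v) / 2, (u - v) / (2 * e))) UNIV (UNIV :: ('a \<times> 'a) set)"
    by (rule bij_betw_byWitness[where f' = "\<lambda>(x, y). (x + e * y, x - e * y)"])
      (use assms two \<open>(4::'a) \<noteq> 0\<close> in \<open>auto simp: field_simps\<close>)
  have "((u + v) / 2)\<^sup>2 - e\<^sup>2 * ((u - v) / (2 * e))\<^sup>2 =
      ((u + v) / 2 - (u - v) / 2) * ((u + v) / 2 + (u - v) / 2)" for u v
  proof -
    have "e * ((u - v) / (2 * e)) = (u - v) / 2" using assms by simp
    then have "e\<^sup>2 * ((u - v) / (2 * e))\<^sup>2 = ((u - v) / 2)\<^sup>2" by (metis power_mult_distrib)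
    then show ?thesis by (simp only: power2_eq_square square_diff_square_factored mult.commute)
  qed
  then have "((u + v) / 2)\<^sup>2 - e\<^sup>2 * ((u - v) / (2 * e))\<^sup>2 = u * v" for u v
    using two by (simp add: add_divide_distrib[symmetric] diff_divide_distrib[symmetric])
  then show "biased UNIV (\<lambda>z. case case z of (u, v) \<Rightarrow> ((u + v) / 2, (u - v) / (2 * e)) of
      (x, y) \<Rightarrow> x\<^sup>2 - e\<^sup>2 * y\<^sup>2) (int CARD('a))"
    using biased_product[where ?'a = 'a] by (simp add: case_prod_unfold)
qed

text \<open>Pigeonhole: the squares and the values \<open>c + d * x ^ 2\<close> each fill more than
  half of the field, so they meet.\<close>

lemma norm_form_surj:
  fixes c d :: "'a::{finite,field}"
  assumes "odd CARD('a)" "d \<noteq> 0"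
  shows "\<exists>s t. s ^ 2 - d * t ^ 2 = c"
proof -
  let ?S = "range (\<lambda>x::'a. x ^ 2)" and ?T = "range (\<lambda>x. c + d * x ^ 2)"
  have "card (?S \<union> ?T) \<le> CARD('a)" by (rule card_mono) auto
  then have "card (?S \<inter> ?T) \<noteq> 0"
    using card_Un_Int[of ?S ?T, OF finite finite] card_squares[OF assms(1)]
      card_scaled_squares[OF assms, of c] by linarith
  then obtain z where "z \<in> ?S" "z \<in> ?T" by (metis Int_iff card.empty ex_in_conv)
  then show ?thesis by (auto simp: diff_eq_eq)
qed

text \<open>Multiplication by an element of norm \<open>c / b\<close> in the quadratic extension maps one fibre into the other.\<close>

lemma card_norm_fibre_le:
  fixes b c d :: "'a::{finite,field}"
  assumes "odd CARD('a)" "d \<noteq> 0" "b \<noteq> 0" "c \<noteq> 0"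
  shows "card {(x, y). x ^ 2 - d * y ^ 2 = b} \<le> card {(x, y). x ^ 2 - d * y ^ 2 = c}"
proof -
  obtain s t where st: "s ^ 2 - d * t ^ 2 = c / b" using norm_form_surj[OF assms(1,2)] by blast
  define D where "D = s ^ 2 - d * t ^ 2"
  have D: "D \<noteq> 0" using st assms by (simp add: D_def)
  let ?h = "\<lambda>(x, y). (s * x + d * t * y, s * y + t * x)"
  show ?thesis
  proof (rule card_inj_on_le)
    \<comment> \<open>Multiplication by the conjugate of \<open>s + t * sqrt d\<close>, divided by
      the norm \<open>D\<close>, undoes \<open>?h\<close>.\<close>
    let ?g = "\<lambda>(x, y). ((s * x - d * t * y) / D, (s * y - t * x) / D)"
    have "s * (s * x + d * t * y) - d * t * (s * y + t * x) = D * x"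
      "s * (s * y + t * x) - t * (s * x + d * t * y) = D * y" for x y
      by (simp_all add: D_def algebra_simps power2_eq_square)
    then have "?g (?h z) = z" for z using D by (auto simp: case_prod_unfold)
    then show "inj_on ?h {(x, y). x ^ 2 - d * y ^ 2 = b}" by (rule inj_on_inverseI)
    have "(s * x + d * t * y) ^ 2 - d * (s * y + t * x) ^ 2 = (s ^ 2 - d * t ^ 2) * (x ^ 2 - d * y ^ 2)" for x y
      by (simp add: algebra_simps power2_eq_square)
    then show "?h ` {(x, y). x ^ 2 - d * y ^ 2 = b} \<subseteq> {(x, y). x ^ 2 - d * y ^ 2 = c}"
      using st assms by auto
  qed auto
qed

text \<open>The form is anisotropic, so 0 has one preimage, and all nonzero fibres have a common
  size F. Counting pairs gives q^2 = 1 + (q - 1) F, so F = q + 1 and the bias is 1 - (q +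
  1).\<close>

lemma biased_norm_form_nonsplit:
  fixes d :: "'a::{finite,field}"
  assumes odd: "odd CARD('a)" and d: "\<not> is_sq d"
  shows "biased UNIV (\<lambda>(x, y). x ^ 2 - d * y ^ 2) (- int CARD('a))"
proof (rule biasedI)
  fix c :: 'a assume c: "c \<noteq> 0"
  have d0: "d \<noteq> 0" using d unfolding is_sq_def by (metis power_zero_numeral)
  let ?N = "\<lambda>(x, y). x ^ 2 - d * y ^ 2"
  let ?F = "\<lambda>b. card {z. ?N z = b}"
  have F: "?F b = ?F c" if "b \<noteq> 0" for b
    using card_norm_fibre_le[OF odd d0 that c] card_norm_fibre_le[OF odd d0 c that]
    by (simp add: case_prod_unfold)
  have "{z. ?N z = 0} = {(0, 0)}"
  proof -
    have "y = 0" if "x ^ 2 - d * y ^ 2 = 0" for x y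
    proof (rule ccontr)
      assume "y \<noteq> 0"
      then have "(x / y) ^ 2 = d" using that by (simp add: power_divide field_simps)
      then show False using d unfolding is_sq_def by blast
    qed
    then show ?thesis by fastforce
  qed
  then have F0: "?F 0 = 1" by simp
  have "CARD('a) * CARD('a) = (\<Sum>b\<in>UNIV. ?F b)"
    using sum.group[of "UNIV :: ('a \<times> 'a) set" UNIV ?N "\<lambda>_. 1::nat"] by simp
  also have "\<dots> = ?F 0 + (\<Sum>b\<in>UNIV - {0}. ?F b)" by (rule sum.remove) auto
  also have "(\<Sum>b\<in>UNIV - {0}. ?F b) = (\<Sum>b\<in>UNIV - {0::'a}. ?F c)"
    by (rule sum.cong) (use F in auto)
  also have "\<dots> = (CARD('a) - 1) * ?F c" by simp
  finally have "CARD('a) * CARD('a) = 1 + (CARD('a) - 1) * ?F c" unfolding F0 .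
  moreover have "int (CARD('a) - 1) = int CARD('a) - 1"
    by (simp add: of_nat_diff Suc_leI)
  ultimately have "int CARD('a) * int CARD('a) = 1 + (int CARD('a) - 1) * int (?F c)"
    by (simp only: of_nat_mult[symmetric] of_nat_add of_nat_1) simp
  then have "(int CARD('a) - 1) * (int (?F c) - (int CARD('a) + 1)) = 0"
    by (simp add: algebra_simps)
  moreover have "CARD('a) \<noteq> 1"
    using card_mono[of UNIV "{0, 1::'a}"] by auto
  ultimately have "int (?F c) = int CARD('a) + 1" by auto
  moreover have "(\<Sum>x\<in>UNIV. of_bool (?N x = 0) - of_bool (?N x = c)) = int (?F 0) - int (?F c)"
    by (simp add: sum_subtractf sum_of_bool_eq)
  ultimately show "(\<Sum>x\<in>UNIV. of_bool (?N x = 0) - of_bool (?N x = c)) = - int CARD('a)"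
    using F0 by simp
qed

text \<open>Rescaling the first variable by \<open>a\<close> turns the form into
  \<open>1 / a\<close> times the norm form with \<open>d = - (a * b)\<close>, which splits exactly
  when this \<open>d\<close> is a square.\<close>

lemma biased_binary_form:
  fixes a b :: "'a::{finite,field}"
  assumes odd: "odd CARD('a)" and a: "a \<noteq> 0" and b: "b \<noteq> 0"
  shows "biased UNIV (\<lambda>(x, y). a * x ^ 2 + b * y ^ 2)
    (if is_sq (- (a * b)) then int CARD('a) else - int CARD('a))"
proof (rule biased_reindex)
  let ?E = "if is_sq (- (a * b)) then int CARD('a) else - int CARD('a)"
  show "bij_betw (\<lambda>(x, y). (x / a, y)) UNIV (UNIV :: ('a \<times> 'a) set)"
    by (rule bij_betw_byWitness[where f' = "\<lambda>(x, y). (a * x, y)"]) (use a in auto)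
  have "biased UNIV (\<lambda>(x, y). x ^ 2 - (- (a * b)) * y ^ 2) ?E"
  proof (cases "is_sq (- (a * b))")
    case True
    then obtain e where e: "e ^ 2 = - (a * b)" by (auto simp: is_sq_def)
    then have "e \<noteq> 0" using a b by auto
    from biased_norm_form_split[OF odd this] show ?thesis using True unfolding e by simp
  next
    case False
    then show ?thesis using biased_norm_form_nonsplit[OF odd False] by simp
  qed
  then have *: "biased UNIV (\<lambda>z. 1 / a * (\<lambda>(x, y). x ^ 2 - (- (a * b)) * y ^ 2) z) ?E"
    by (rule biased_scale) (use a in simp)
  have "1 / a * (x ^ 2 - (- (a * b)) * y ^ 2) = a * (x / a) ^ 2 + b * y ^ 2" for x y
    using a by (simp add: power_divide field_simps power2_eq_square)
  with * show "biased UNIV (\<lambda>z. case case z of (x, y) \<Rightarrow> (x / a, y) of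
      (x, y) \<Rightarrow> a * x\<^sup>2 + b * y\<^sup>2) ?E"
    by (simp add: case_prod_unfold)
qed

section \<open>Diagonal forms in an even number of variables\<close>

definition vecs :: "nat \<Rightarrow> 'b::zero set \<Rightarrow> (nat \<Rightarrow> 'b) set" where
  "vecs n V = {x. (\<forall>i<n. x i \<in> V) \<and> (\<forall>i\<ge>n. x i = 0)}"

lemma vecs_0: "vecs 0 V = {\<lambda>_. 0}"
  by (auto simp: vecs_def)

lemma bij_betw_vecs_Suc:
  "bij_betw (\<lambda>(v, x). x(n := v)) (V \<times> vecs n V) (vecs (Suc n) V)"
  by (rule bij_betw_byWitness[where f' = "\<lambda>x. (x n, x(n := 0))"])
    (auto simp: vecs_def less_Suc_eq intro!: ext)

lemma card_vecs: "card (vecs n V) = card V ^ n"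
proof (induction n)
  case (Suc n)
  then show ?case
    using bij_betw_same_card[OF bij_betw_vecs_Suc[of n V]] by (simp add: card_cartesian_product)
qed (simp add: vecs_0)

text \<open>The variables are split off in pairs. Each pair contributes a bias q or -q and one minus
  sign to the discriminant; these signs multiply as the quadratic character does, by
  \<open>is_sq_mult_iff\<close>.\<close>

lemma biased_even_form:
  fixes a :: "nat \<Rightarrow> 'a::{finite,field}"
  assumes odd: "odd CARD('a)" and a: "\<forall>i<2 * m. a i \<noteq> 0"
  shows "biased (vecs (2 * m) UNIV) (\<lambda>x. \<Sum>i<2 * m. a i * x i ^ 2)
    (if is_sq ((-1) ^ m * (\<Prod>i<2 * m. a i)) then int CARD('a) ^ m else - (int CARD('a) ^ m))"
  using a
proof (induction m)
  case 0
  have "is_sq (1::'a)" unfolding is_sq_def by (metis one_power2)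
  then show ?case by (simp add: vecs_0 biased_def)
next
  case (Suc m)
  let ?n = "2 * m" and ?q = "int CARD('a)"
  let ?d = "(-1) ^ m * (\<Prod>i<?n. a i)" and ?e = "- (a ?n * a (Suc ?n))"
  let ?E = "if is_sq ?d then ?q ^ m else - (?q ^ m)" and ?F = "if is_sq ?e then ?q else - ?q"
  have nz: "?d \<noteq> 0" "?e \<noteq> 0" using Suc.prems by auto
  have IH: "biased (vecs ?n UNIV) (\<lambda>x. \<Sum>i<?n. a i * x i ^ 2) ?E" using Suc by auto
  have bin: "biased UNIV (\<lambda>(x, y). a ?n * x ^ 2 + a (Suc ?n) * y ^ 2) ?F"
    by (rule biased_binary_form[OF odd]) (use Suc.prems in auto)
  have "bij_betw (\<lambda>((u, v), x). x(?n := u, Suc ?n := v)) (UNIV \<times> vecs ?n UNIV) (vecs (2 * Suc m) (UNIV :: 'a set))"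
    by (rule bij_betw_byWitness[where f' = "\<lambda>x. ((x ?n, x (Suc ?n)), x(?n := 0, Suc ?n := 0))"])
      (auto simp: vecs_def less_Suc_eq intro!: ext)
  moreover have "biased (UNIV \<times> vecs ?n UNIV)
      (\<lambda>z. \<Sum>i<2 * Suc m. a i * (\<lambda>((u, v), x). x(?n := u, Suc ?n := v)) z i ^ 2) (?F * ?E)"
    using biased_sum[OF bin IH]
    by (rule biased_cong[THEN iffD1, rotated]) (auto simp: algebra_simps)
  ultimately have "biased (vecs (2 * Suc m) UNIV) (\<lambda>x. \<Sum>i<2 * Suc m. a i * x i ^ 2) (?F * ?E)"
    by (rule biased_reindex[where h = "\<lambda>((u, v), x). x(?n := u, Suc ?n := v)"])
  moreover have "(-1) ^ Suc m * (\<Prod>i<2 * Suc m. a i) = ?d * ?e" by (simp add: algebra_simps)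
  moreover have "?F * ?E = (if is_sq (?d * ?e) then ?q ^ Suc m else - (?q ^ Suc m))"
    using is_sq_mult_iff[OF odd nz] by auto
  ultimately show ?case by (simp only:)
qed

section \<open>Orthogonal decomposition of tensor forms\<close>

locale finite_field_space = vector_space scale
  for scale :: "'a::{finite,field} \<Rightarrow> 'b::ab_group_add \<Rightarrow> 'b"
begin

text \<open>The analogue of orthogonality of characters: if \<open>l\<close> is nonzero on
  \<open>U\<close>, translation by a vector of value \<open>c\<close> carries the kernel onto the
  fibre over \<open>c\<close>.\<close>

lemma biased_linear_functional:
  fixes l :: "'b \<Rightarrow> 'a"
  assumes U: "subspace U" and fin: "finite U"
    and add: "\<And>x y. l (x + y) = l x + l y" and sc: "\<And>k x. l (scale k x) = k * l x"
  shows "biased U l (if \<forall>x\<in>U. l x = 0 then int (card U) else 0)"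
proof (cases "\<forall>x\<in>U. l x = 0")
  case True
  then show ?thesis using biased_zero[of U] biased_cong[of U l "\<lambda>_. 0"] by auto
next
  case False
  then obtain u where u: "u \<in> U" "l u \<noteq> 0" by auto
  have "biased U l 0"
  proof (rule biasedI)
    fix c :: 'a assume "c \<noteq> 0"
    define v where "v = scale (c / l u) u"
    have v: "v \<in> U" "l v = c" using u U by (auto simp: v_def sc subspace_scale)
    have diff: "l (x - v) = l x - c" for x
      using add[of "x - v" v] v by (simp add: algebra_simps)
    have "bij_betw (\<lambda>x. x + v) {x \<in> U. l x = 0} {x \<in> U. l x = c}"
      by (rule bij_betw_byWitness[where f' = "\<lambda>x. x - v"])
        (use v U add diff in \<open>auto simp: subspace_add subspace_diff\<close>)
    then have "card {x \<in> U. l x = 0} = card {x \<in> U. l x = c}" by (rule bij_betw_same_card)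
    then show "(\<Sum>x\<in>U. of_bool (l x = 0) - of_bool (l x = c)) = (0::int)"
      using fin by (simp add: sum_subtractf sum_of_bool_eq Int_def)
  qed
  then show ?thesis using False by (simp only: if_False)
qed

lemma card_kernel:
  fixes l :: "'b \<Rightarrow> 'a"
  assumes U: "subspace U" and fin: "finite U"
    and add: "\<And>x y. l (x + y) = l x + l y" and sc: "\<And>k x. l (scale k x) = k * l x"
    and nz: "\<exists>x\<in>U. l x \<noteq> 0"
  shows "card U = CARD('a) * card {x \<in> U. l x = 0}"
proof -
  have "\<not> (\<forall>x\<in>U. l x = 0)" using nz by blast
  with biased_linear_functional[OF U fin, of l, OF add sc] have b: "biased U l 0"
    by (simp only: if_False)
  have eq: "card {x \<in> U. l x = c} = card {x \<in> U. l x = 0}" for c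
  proof (cases "c = 0")
    case False
    from biasedD[OF b this] show ?thesis
      using fin by (simp add: sum_subtractf sum_of_bool_eq Int_def)
  qed simp
  have "card U = (\<Sum>c\<in>UNIV. card {x \<in> U. l x = c})"
    using sum.group[of U UNIV l "\<lambda>_. 1::nat"] fin by simp
  also have "\<dots> = (\<Sum>c\<in>(UNIV :: 'a set). card {x \<in> U. l x = 0})"
    by (rule sum.cong) (use eq in auto)
  finally show ?thesis by simp
qed

definition radical :: "('b \<Rightarrow> 'b \<Rightarrow> 'a) \<Rightarrow> 'b set \<Rightarrow> 'b set" where
  "radical B V = {x \<in> V. \<forall>y\<in>V. B x y = 0}"

text \<open>Diagonalization of \<open>B\<close>, with \<open>r\<close> its rank on \<open>V\<close>.
  A vector \<open>v\<close> with \<open>B v v\<close> nonzero splits \<open>V\<close> into the line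
  of \<open>v\<close> and its orthogonal complement; the coordinates along \<open>v\<close> carry a
  nonzero multiple of the base form, which again has bias \<open>E\<close>.\<close>

lemma biased_tensor_form:
  fixes B :: "'b \<Rightarrow> 'b \<Rightarrow> 'a" and a :: "nat \<Rightarrow> 'a"
  assumes odd: "odd CARD('a)"
    and sym: "\<And>x y. B x y = B y x"
    and add: "\<And>x y z. B x (y + z) = B x y + B x z"
    and sc: "\<And>k x y. B x (scale k y) = k * B x y"
    and base: "biased (vecs n UNIV) (\<lambda>c. \<Sum>i<n. a i * c i ^ 2) E"
    and V: "subspace V" "finite V"
  shows "\<exists>r. card V = CARD('a) ^ r * card (radical B V) \<and>
    biased (vecs n V) (\<lambda>x. \<Sum>i<n. a i * B (x i) (x i)) (E ^ r * int (card (radical B V)) ^ n)"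
  using V
proof (induction "card V" arbitrary: V rule: less_induct)
  case less
  note V = less.prems
  have add': "B (y + z) x = B y x + B z x" and sc': "B (scale k y) x = k * B y x" for k x y z
    using add sc sym by metis+
  show ?case
  proof (cases "\<forall>v\<in>V. B v v = 0")
    \<comment> \<open>Polarization makes \<open>B\<close> vanish on \<open>V\<close>, as 2 is
      invertible. So all of \<open>V\<close> is radical and \<open>r = 0\<close>.\<close>
    case True
    have two: "(2::'a) \<noteq> 0" by (rule two_neq_0_if_odd_card) fact
    have "B x y = 0" if "x \<in> V" "y \<in> V" for x y
    proof -
      have "B (x + y) (x + y) = B x x + B y y + 2 * B x y"
        by (simp add: add add' sym[of y x])
      then show ?thesis using True that V two by (simp add: subspace_add)
    qed
    then have "radical B V = V" by (auto simp: radical_def)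
    moreover have "biased (vecs n V) (\<lambda>x. \<Sum>i<n. a i * B (x i) (x i)) (int (card V) ^ n)"
      using biased_zero[of "vecs n V"] True unfolding card_vecs of_nat_power
      by (subst biased_cong[where g = "\<lambda>_. 0"]) (auto simp: vecs_def intro!: sum.neutral)
    ultimately show ?thesis by (intro exI[of _ 0]) simp
  next
    case False
    then obtain v where v: "v \<in> V" "B v v \<noteq> 0" by auto
    define W where "W = {w \<in> V. B v w = 0}"
    have B0: "B x 0 = 0" for x using sc[of x 0 0] by simp
    have W: "subspace W" "finite W"
      using V by (auto simp: W_def subspace_def add sc B0)
    have proj: "x - scale (B v x / B v v) v \<in> W" if "x \<in> V" for x
    proof -
      have "B v x = B v (x - scale (B v x / B v v) v) + B v (scale (B v x / B v v) v)"
        by (simp flip: add)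
      then show ?thesis using that V v
        by (simp add: W_def sc subspace_diff subspace_scale)
    qed
    have cardV: "card V = CARD('a) * card W"
      unfolding W_def by (rule card_kernel) (use V add sc v in auto)
    have "card W < card V"
      by (rule psubset_card_mono) (use V v in \<open>auto simp: W_def\<close>)
    from less.hyps[OF this W] obtain r where r: "card W = CARD('a) ^ r * card (radical B W)"
      "biased (vecs n W) (\<lambda>x. \<Sum>i<n. a i * B (x i) (x i)) (E ^ r * int (card (radical B W)) ^ n)"
      by blast
    \<comment> \<open>What is orthogonal to \<open>W\<close> and to \<open>v\<close> is orthogonal
      to all of \<open>V\<close>; conversely, the radical of \<open>V\<close> lies in
      \<open>W\<close> because it is orthogonal to \<open>v\<close>.\<close>
    have rad: "radical B W = radical B V"
    proof (rule set_eqI)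
      fix x
      show "x \<in> radical B W \<longleftrightarrow> x \<in> radical B V"
      proof
        assume x: "x \<in> radical B W"
        then have xv: "B x v = 0" using sym[of x v] by (simp add: radical_def W_def)
        have "B x y = 0" if "y \<in> V" for y
        proof -
          let ?s = "scale (B v y / B v v) v"
          have "B x y = B x (y - ?s) + B x ?s" by (simp flip: add)
          also have "\<dots> = 0" using proj[OF that] x xv by (simp add: sc radical_def)
          finally show ?thesis .
        qed
        then show "x \<in> radical B V" using x by (auto simp: radical_def W_def)
      next
        assume "x \<in> radical B V"
        then show "x \<in> radical B W" using v sym[of x v] by (simp add: radical_def W_def)
      qed
    qed
    \<comment> \<open>The decomposition entry by entry: \<open>c i\<close> is the coefficient along
      \<open>v\<close>, and \<open>w i\<close> the part in \<open>W\<close>.\<close>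
    let ?h = "\<lambda>(c, w) i. scale (c i) v + w i"
    have "bij_betw ?h (vecs n UNIV \<times> vecs n W) (vecs n V)"
    proof (rule bij_betw_byWitness[where f' = "\<lambda>x. (\<lambda>i. B v (x i) / B v v, \<lambda>i. x i - scale (B v (x i) / B v v) v)"])
      have "B v (scale (c i) v + w i) = c i * B v v" if "w \<in> vecs n W" for c w i
        using that by (cases "i < n") (auto simp: vecs_def W_def add sc B0)
      then show "\<forall>z\<in>vecs n UNIV \<times> vecs n W.
          (\<lambda>i. B v (?h z i) / B v v, \<lambda>i. ?h z i - scale (B v (?h z i) / B v v) v) = z"
        using v by (auto intro!: ext)
      show "?h ` (vecs n UNIV \<times> vecs n W) \<subseteq> vecs n V"
        using V v by (auto simp: vecs_def W_def intro!: subspace_add subspace_scale)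
      show "(\<lambda>x. (\<lambda>i. B v (x i) / B v v, \<lambda>i. x i - scale (B v (x i) / B v v) v)) ` vecs n V
          \<subseteq> vecs n UNIV \<times> vecs n W"
        using proj by (auto simp: vecs_def B0)
    qed auto
    moreover have "biased (vecs n UNIV \<times> vecs n W) (\<lambda>z. \<Sum>i<n. a i * B (?h z i) (?h z i))
        (E * (E ^ r * int (card (radical B W)) ^ n))"
    proof -
      have "(\<Sum>i<n. a i * B (?h (c, w) i) (?h (c, w) i)) =
          B v v * (\<Sum>i<n. a i * c i ^ 2) + (\<Sum>i<n. a i * B (w i) (w i))"
        if "w \<in> vecs n W" for c w
      proof -
        have "B (scale (c i) v + w i) (scale (c i) v + w i) = B v v * c i ^ 2 + B (w i) (w i)"
          if "i < n" for i
          using that \<open>w \<in> vecs n W\<close>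
          by (simp add: vecs_def W_def add add' sc sc' sym[of "w i" v] power2_eq_square)
        then show ?thesis by (simp add: sum_distrib_left sum.distrib algebra_simps)
      qed
      then show ?thesis
        using biased_sum[OF biased_scale[OF base v(2)] r(2)]
        by (subst biased_cong[where g = "\<lambda>(c, w). B v v * (\<Sum>i<n. a i * c i ^ 2) + (\<Sum>i<n. a i * B (w i) (w i))"])
          auto
    qed
    ultimately have "biased (vecs n V) (\<lambda>x. \<Sum>i<n. a i * B (x i) (x i))
        (E * (E ^ r * int (card (radical B W)) ^ n))"
      by (rule biased_reindex[where h = ?h])
    then show ?thesis using cardV r(1) rad by (intro exI[of _ "Suc r"]) (simp add: mult.assoc)
  qed
qed

text \<open>As for characters: summing \<open>[B x u = 0] - [B x u = 1]\<close> over \<open>x\<close> and \<open>u\<close> in either order.\<close>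

lemma card_annihilator:
  fixes B :: "'b \<Rightarrow> 'b \<Rightarrow> 'a"
  assumes sym: "\<And>x y. B x y = B y x"
    and add: "\<And>x y z. B x (y + z) = B x y + B x z"
    and sc: "\<And>k x y. B x (scale k y) = k * B x y"
    and U: "subspace U" and V: "subspace V" "finite V" and sub: "U \<subseteq> V"
    and nondeg: "radical B V = {0}"
  shows "card {x \<in> V. \<forall>u\<in>U. B x u = 0} * card U = card V"
proof -
  have finU: "finite U" using V sub finite_subset by blast
  let ?\<chi> = "\<lambda>z. of_bool (z = 0) - of_bool (z = 1) :: int"
  have lin: "biased T (B x) (if \<forall>y\<in>T. B x y = 0 then int (card T) else 0)"
    if "subspace T" "finite T" for T x
    by (rule biased_linear_functional) (use that add sc in auto)
  have "int (card {x \<in> V. \<forall>u\<in>U. B x u = 0} * card U) = (\<Sum>x\<in>V. if \<forall>u\<in>U. B x u = 0 then int (card U) else 0)"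
    using V by (simp add: sum.If_cases Int_def)
  also have "\<dots> = (\<Sum>x\<in>V. \<Sum>u\<in>U. ?\<chi> (B x u))"
    using biasedD[OF lin[OF U finU] one_neq_zero] by simp
  also have "\<dots> = (\<Sum>u\<in>U. \<Sum>x\<in>V. ?\<chi> (B u x))"
    by (subst sum.swap) (simp only: sym)
  also have "\<dots> = (\<Sum>u\<in>U. if \<forall>x\<in>V. B u x = 0 then int (card V) else 0)"
    using biasedD[OF lin[OF V] one_neq_zero] by simp
  also have "\<dots> = (\<Sum>u\<in>U. if u = 0 then int (card V) else 0)"
    using nondeg sub V by (intro sum.cong refl) (auto simp: radical_def)
  also have "\<dots> = int (card V)" using finU subspace_0[OF U] by simp
  finally show ?thesis by (simp only: of_nat_eq_iff)
qed

end

section \<open>Polynomials of bounded degree and the coefficient pairing\<close>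

section \<open>Hankel kernels\<close>

text \<open>Coefficients are used because \<open>degree 0 = 0\<close>, whereas the zero polynomial
  must lie in every \<open>deg_less b\<close>, also for \<open>b = 0\<close>.\<close>

definition deg_less :: "nat \<Rightarrow> 'a::zero poly set" where
  "deg_less b = {p. \<forall>i\<ge>b. coeff p i = 0}"

lemma deg_less_iff: "p \<in> deg_less b \<longleftrightarrow> p = 0 \<or> degree p < b"
  by (auto simp: deg_less_def coeff_eq_0 intro: ccontr leading_coeff_0_iff[THEN iffD1])

lemma deg_less_0: "deg_less 0 = {0}"
  by (auto simp: deg_less_iff)

lemma deg_less_Suc: "p \<in> deg_less (Suc b) \<Longrightarrow> p \<in> deg_less b \<longleftrightarrow> coeff p b = 0"
  by (auto simp: deg_less_def) (metis Suc_leI le_neq_implies_less)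

lemma deg_less_mono: "b \<le> c \<Longrightarrow> deg_less b \<subseteq> deg_less c"
  by (auto simp: deg_less_def)

text \<open>Degrees at most \<open>b - 1\<close> and \<open>c - 1\<close> add up to at most
  \<open>b + c - 2\<close>, hence the slack of one.\<close>

lemma deg_less_mult:
  fixes x y :: "'a::idom poly"
  assumes "x \<in> deg_less b" "y \<in> deg_less c" "b + c \<le> Suc d"
  shows "x * y \<in> deg_less d"
  using assms by (cases "x = 0 \<or> y = 0") (auto simp: deg_less_iff degree_mult_eq)

lemma finite_deg_less: "finite (deg_less b :: 'a::{finite,zero} poly set)"
  and card_deg_less: "card (deg_less b :: 'a::{finite,zero} poly set) = CARD('a) ^ b"
proof (induction b)
  case (Suc b)
  have bij: "bij_betw (\<lambda>(a, p). pCons a p) (UNIV \<times> deg_less b) (deg_less (Suc b) :: 'a poly set)"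
  proof (rule bij_betwI')
    fix p :: "'a poly" assume p: "p \<in> deg_less (Suc b)"
    obtain a r where r: "p = pCons a r" by (cases p)
    have "coeff r i = coeff p (Suc i)" for i by (simp add: r)
    then have "r \<in> deg_less b" using p by (simp add: deg_less_def)
    then show "\<exists>z\<in>UNIV \<times> deg_less b. p = (case z of (a, p) \<Rightarrow> pCons a p)" using r by auto
  qed (auto simp: deg_less_def coeff_pCons split: nat.splits)
  { case 1 show ?case using Suc bij_betw_finite[OF bij] by auto }
  { case 2 show ?case using Suc bij_betw_same_card[OF bij] by (simp add: card_cartesian_product) }
qed (simp_all add: deg_less_0)

interpretation poly_space: finite_field_space "smult :: 'a::{finite,field} \<Rightarrow> 'a poly \<Rightarrow> 'a poly"
  by unfold_locales (simp_all add: smult_add_left smult_add_right)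

lemma subspace_deg_less: "poly_space.subspace (deg_less b :: 'a::{finite,field} poly set)"
  by (auto simp: poly_space.subspace_def deg_less_def)

text \<open>The polynomial \<open>\<alpha>\<close> stands for a linear functional on polynomials of
  degree below \<open>d\<close>. Functionals and arguments thus live in one space, and the pairing
  is symmetric.\<close>

definition coeff_pairing :: "nat \<Rightarrow> 'a::comm_semiring_0 poly \<Rightarrow> 'a poly \<Rightarrow> 'a" where
  "coeff_pairing d \<alpha> p = (\<Sum>i<d. coeff \<alpha> i * coeff p i)"

lemma coeff_pairing_commute: "coeff_pairing d \<alpha> p = coeff_pairing d p \<alpha>"
  by (simp add: coeff_pairing_def mult.commute)

lemma coeff_pairing_add: "coeff_pairing d \<alpha> (p + r) = coeff_pairing d \<alpha> p + coeff_pairing d \<alpha> r"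
  by (simp add: coeff_pairing_def algebra_simps sum.distrib)

lemma coeff_pairing_smult: "coeff_pairing d \<alpha> (smult k p) = k * coeff_pairing d \<alpha> p"
  by (simp add: coeff_pairing_def sum_distrib_left mult_ac)

lemma coeff_pairing_0: "coeff_pairing d \<alpha> 0 = 0"
  by (simp add: coeff_pairing_def)

lemma coeff_pairing_sum: "coeff_pairing d \<alpha> (\<Sum>i\<in>A. p i) = (\<Sum>i\<in>A. coeff_pairing d \<alpha> (p i))"
  by (induction A rule: infinite_finite_induct) (simp_all add: coeff_pairing_0 coeff_pairing_add)

lemma coeff_pairing_nondegenerate:
  "poly_space.radical (coeff_pairing d) (deg_less d) = {0 :: 'a::{finite,field} poly}"
proof -
  have "p = 0" if p: "p \<in> deg_less d" "\<forall>y\<in>deg_less d. coeff_pairing d p y = 0" for p :: "'a poly"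
  proof (rule poly_eqI)
    fix i show "coeff p i = coeff 0 i"
    proof (cases "i < d")
      case True
      then have "monom 1 i \<in> (deg_less d :: 'a poly set)" by (simp add: deg_less_def)
      moreover have "coeff_pairing d p (monom 1 i) = coeff p i"
        using True by (simp add: coeff_pairing_def of_bool_def if_distrib cong: if_cong)
      ultimately show ?thesis using p by simp
    qed (use p in \<open>simp add: deg_less_def\<close>)
  qed
  then show ?thesis by (auto simp: poly_space.radical_def deg_less_def coeff_pairing_def)
qed

section \<open>Kernels of Hankel matrices and their dimensions\<close>

text \<open>The kernel of the \<open>(2P - b) \<times> b\<close> Hankel matrix of \<open>\<alpha>\<close>.\<close>

definition hankel_ker :: "nat \<Rightarrow> 'a::field poly \<Rightarrow> nat \<Rightarrow> 'a poly set" where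
  "hankel_ker P \<alpha> b = {x \<in> deg_less b. \<forall>y\<in>deg_less (2 * P - b). coeff_pairing (2 * P - 1) \<alpha> (x * y) = 0}"

lemma subspace_hankel_ker:
  "poly_space.subspace (hankel_ker P \<alpha> b :: 'a::{finite,field} poly set)"
  by (auto simp: poly_space.subspace_def hankel_ker_def deg_less_def coeff_pairing_0 distrib_right
      coeff_pairing_add coeff_pairing_smult)

lemma finite_hankel_ker: "finite (hankel_ker P \<alpha> b :: 'a::{finite,field} poly set)"
  by (rule finite_subset[OF _ finite_deg_less[of b]]) (auto simp: hankel_ker_def)

lemma zero_in_hankel_ker: "0 \<in> hankel_ker P \<alpha> b"
  by (simp add: hankel_ker_def deg_less_iff coeff_pairing_0)

lemma hankel_ker_0: "hankel_ker P \<alpha> 0 = {0}"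
  using zero_in_hankel_ker[of P \<alpha> 0] by (auto simp: hankel_ker_def deg_less_0)

lemma hankel_ker_mono: "b \<le> c \<Longrightarrow> hankel_ker P \<alpha> b \<subseteq> hankel_ker P \<alpha> c"
  using deg_less_mono[of b c, where ?'a = 'a] deg_less_mono[of "2 * P - c" "2 * P - b", where ?'a = 'a]
  by (fastforce simp: hankel_ker_def)

lemma split_leading:
  fixes y :: "'a::comm_ring_1 poly"
  assumes "y \<in> deg_less (Suc e)"
  obtains z where "z \<in> deg_less e" "y = z + smult (coeff y e) (monom 1 e)"
proof
  have "y - smult (coeff y e) (monom 1 e) \<in> deg_less (Suc e)"
    using assms by (simp add: deg_less_def)
  then show "y - smult (coeff y e) (monom 1 e) \<in> deg_less e"
    by (simp add: deg_less_Suc)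
qed simp

text \<open>Going from \<open>Suc b\<close> down to \<open>b\<close> adds two linear conditions: the
  degree bound on \<open>x\<close> drops by one, and one new monomial joins the test
  polynomials.\<close>

lemma hankel_ker_iff:
  assumes "b < P" "x \<in> hankel_ker P \<alpha> (Suc b)"
  shows "x \<in> hankel_ker P \<alpha> b \<longleftrightarrow>
    coeff x b = 0 \<and> coeff_pairing (2 * P - 1) \<alpha> (x * monom 1 (2 * P - Suc b)) = 0"
proof -
  let ?e = "2 * P - Suc b"
  have e: "2 * P - b = Suc ?e" using assms by simp
  have x: "x \<in> deg_less (Suc b)" "\<And>y. y \<in> deg_less ?e \<Longrightarrow> coeff_pairing (2 * P - 1) \<alpha> (x * y) = 0"
    using assms by (auto simp: hankel_ker_def)
  have "x \<in> deg_less b \<longleftrightarrow> coeff x b = 0"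
    using x(1) by (rule deg_less_Suc)
  moreover have "(\<forall>y\<in>deg_less (2 * P - b). coeff_pairing (2 * P - 1) \<alpha> (x * y) = 0) \<longleftrightarrow>
      coeff_pairing (2 * P - 1) \<alpha> (x * monom 1 ?e) = 0" (is "?L \<longleftrightarrow> ?R")
  proof
    assume ?L
    moreover have "monom 1 ?e \<in> (deg_less (2 * P - b) :: 'a poly set)"
      unfolding e by (simp add: deg_less_def)
    ultimately show ?R by blast
  next
    assume R: ?R
    show ?L
    proof
      fix y :: "'a poly" assume "y \<in> deg_less (2 * P - b)"
      then obtain z where z: "z \<in> deg_less ?e" "y = z + smult (coeff y ?e) (monom 1 ?e)"
        unfolding e by (rule split_leading)
      show "coeff_pairing (2 * P - 1) \<alpha> (x * y) = 0"
        by (subst z(2)) (simp only: R x(2)[OF z(1)] coeff_pairing_add coeff_pairing_smult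
            distrib_left mult_smult_right mult_zero_right add_0)
    qed
  qed
  ultimately show ?thesis by (simp add: hankel_ker_def)
qed

text \<open>The factor t moves from \<open>x\<close> to the test polynomial, whose degree bound is
  one lower at \<open>Suc b\<close>.\<close>

lemma shift_hankel_ker:
  assumes "x \<in> hankel_ker P \<alpha> b" "b < P"
  shows "monom 1 1 * x \<in> hankel_ker P \<alpha> (Suc b)"
proof -
  have m: "monom 1 1 \<in> (deg_less 2 :: 'a poly set)" by (simp add: deg_less_def)
  have "monom 1 1 * x \<in> deg_less (Suc b)"
    using assms by (intro deg_less_mult[OF m]) (auto simp: hankel_ker_def)
  moreover have "coeff_pairing (2 * P - 1) \<alpha> (monom 1 1 * x * y) = 0" if "y \<in> deg_less (2 * P - Suc b)" for y
  proof -
    have "monom 1 1 * y \<in> deg_less (2 * P - b)"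
      using assms(2) by (intro deg_less_mult[OF m that]) simp
    then have "coeff_pairing (2 * P - 1) \<alpha> (x * (monom 1 1 * y)) = 0"
      using assms(1) by (simp add: hankel_ker_def)
    then show ?thesis by (simp only: mult_ac)
  qed
  ultimately show ?thesis by (simp add: hankel_ker_def)
qed

text \<open>The two conditions of \<open>hankel_ker_iff\<close> together have codimension one. If
  some kernel element has degree exactly \<open>b\<close>, the coefficient condition implies the
  other one. If none has, the coefficient condition is void, and the other one is not.\<close>

lemma card_hankel_ker_Suc:
  fixes \<alpha> :: "'a::{finite,field} poly"
  assumes b: "b < P" and nz: "hankel_ker P \<alpha> (Suc b) \<noteq> {0}"
  shows "card (hankel_ker P \<alpha> (Suc b)) = CARD('a) * card (hankel_ker P \<alpha> b)"
proof -
  let ?K = "hankel_ker P \<alpha>" and ?\<phi> = "coeff_pairing (2 * P - 1) \<alpha>" and ?e = "2 * P - Suc b"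
  note iff = hankel_ker_iff[OF b, of _ \<alpha>]
  have sub: "?K b \<subseteq> ?K (Suc b)" by (rule hankel_ker_mono) simp
  note kernel = poly_space.card_kernel[of "?K (Suc b)", OF subspace_hankel_ker finite_hankel_ker]
  show ?thesis
  proof (cases "\<exists>y\<in>?K (Suc b). coeff y b \<noteq> 0")
    case True
    then obtain y where y: "y \<in> ?K (Suc b)" "coeff y b \<noteq> 0" by auto
    have "?\<phi> (x * monom 1 ?e) = 0" if x: "x \<in> ?K (Suc b)" "coeff x b = 0" for x
    proof -
      let ?m = "monom 1 (?e - b) :: 'a poly"
      \<comment> \<open>\<open>y\<close> has exact degree \<open>b\<close>, so \<open>y t\<^sup>e\<^sup>-\<^sup>b\<close> can replace \<open>t\<^sup>e\<close> as a test polynomial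
        for \<open>x\<close>, and by symmetry \<open>y\<close> annihilates \<open>x t\<^sup>e\<^sup>-\<^sup>b\<close>.\<close>
      have be: "b + (?e - b) = ?e" using b by simp
      have m: "?m \<in> deg_less (Suc (?e - b))" by (simp add: deg_less_def)
      obtain z where z: "z \<in> deg_less b" "y = z + smult (coeff y b) (monom 1 b)"
        using y by (auto simp: hankel_ker_def elim: split_leading)
      have xb: "x \<in> deg_less b"
        using x by (auto simp: hankel_ker_def deg_less_Suc)
      have "?\<phi> (y * (x * ?m)) = 0"
        using y(1) deg_less_mult[OF xb m, of ?e] be by (simp add: hankel_ker_def)
      moreover have "?\<phi> (x * (z * ?m)) = 0"
        using x(1) deg_less_mult[OF z(1) m, of ?e] be by (simp add: hankel_ker_def)
      moreover have "y * (x * ?m) = x * (z * ?m) + smult (coeff y b) (x * monom 1 ?e)"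
      proof -
        have "monom 1 ?e = (monom 1 b * ?m :: 'a poly)" by (simp only: mult_monom be mult_1)
        then show ?thesis by (subst z(2)) (simp add: algebra_simps)
      qed
      ultimately show ?thesis using y(2) by (simp add: coeff_pairing_add coeff_pairing_smult)
    qed
    then have "{x \<in> ?K (Suc b). coeff x b = 0} = ?K b" using iff sub by auto
    then show ?thesis using kernel[of "\<lambda>x. coeff x b"] True by auto
  next
    case False
    let ?l = "\<lambda>x. ?\<phi> (x * monom 1 ?e)"
    have ker: "{x \<in> ?K (Suc b). ?l x = 0} = ?K b" using iff sub False by auto
    have "\<exists>x\<in>?K (Suc b). ?l x \<noteq> 0"
    proof (rule ccontr)
      assume "\<not> ?thesis"
      then have eq: "?K (Suc b) = ?K b" using ker by auto
      obtain x where x: "x \<in> ?K b" "x \<noteq> 0"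
        using nz zero_in_hankel_ker[of P \<alpha> "Suc b"] eq by auto
      \<comment> \<open>A kernel closed under multiplication by t would contain nonzero elements of
        arbitrarily large degree.\<close>
      have "monom 1 n * x \<in> ?K b" for n
      proof (induction n)
        case (Suc n)
        have "monom 1 1 * (monom 1 n * x) \<in> ?K b" using shift_hankel_ker[OF Suc b] eq by simp
        then show ?case by (simp add: mult_monom flip: mult.assoc)
      qed (use x in simp)
      then have "monom 1 b * x \<in> deg_less b" by (simp add: hankel_ker_def)
      then show False using x by (simp add: deg_less_iff degree_mult_eq degree_monom_eq)
    qed
    then show ?thesis using kernel[of ?l] ker
      by (simp add: distrib_right coeff_pairing_add coeff_pairing_smult)
  qed
qed

text \<open>Double counting of the pairs of \<open>\<alpha>\<close> and a kernel element
  \<open>x\<close>. All q^(2P-1) functionals admit \<open>x = 0\<close>. For nonzero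
  \<open>x\<close>, the multiples of \<open>x\<close> by test polynomials form a space of dimension
  \<open>2 * P - b\<close>, which leaves q^(b-1) functionals. The factor \<open>CARD('a)\<close>
  clears the -1 in both exponents.\<close>

lemma sum_card_hankel_ker:
  assumes b: "b \<le> P" and P: "P \<ge> 1"
  shows "int CARD('a) * (\<Sum>\<alpha>\<in>(deg_less (2 * P - 1) :: 'a::{finite,field} poly set). int (card (hankel_ker P \<alpha> b))) =
    int CARD('a) ^ (2 * P) + (int CARD('a) ^ b - 1) * int CARD('a) ^ b"
proof -
  let ?d = "2 * P - 1" and ?q = "CARD('a)"
  let ?D = "deg_less ?d :: 'a poly set"
  define A where "A x = {\<alpha> \<in> ?D. \<forall>y\<in>deg_less (2 * P - b). coeff_pairing ?d \<alpha> (x * y) = 0}" for x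
  have A0: "?q * card (A 0) = ?q ^ (2 * P)"
    using P by (simp add: A_def coeff_pairing_0 card_deg_less flip: power_Suc)
  have A: "?q * card (A x) = ?q ^ b" if x: "x \<in> deg_less b" "x \<noteq> 0" for x
  proof -
    let ?U = "(\<lambda>y. x * y) ` deg_less (2 * P - b)"
    have "card {\<alpha> \<in> ?D. \<forall>u\<in>?U. coeff_pairing ?d \<alpha> u = 0} * card ?U = card ?D"
    proof (rule poly_space.card_annihilator)
      show "poly_space.subspace ?U"
        using subspace_deg_less[of "2 * P - b", where ?'a = 'a]
        by (auto simp: poly_space.subspace_def image_iff simp flip: distrib_left mult_smult_right)
      show "?U \<subseteq> ?D" using x b by (auto intro!: deg_less_mult)
    qed (use coeff_pairing_commute in \<open>auto simp: coeff_pairing_add coeff_pairing_smult subspace_deg_less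
        finite_deg_less coeff_pairing_nondegenerate\<close>)
    moreover have "card ?U = ?q ^ (2 * P - b)"
      using x by (subst card_image) (auto simp: inj_on_def card_deg_less)
    ultimately have "card (A x) * ?q ^ (2 * P - b) = ?q ^ ?d" by (simp add: A_def card_deg_less)
    then have "?q * card (A x) * ?q ^ (2 * P - b) = ?q ^ Suc ?d" by simp
    also have "\<dots> = ?q ^ b * ?q ^ (2 * P - b)" using b P by (simp flip: power_add)
    finally show ?thesis by simp
  qed
  have "(\<Sum>\<alpha>\<in>?D. card (hankel_ker P \<alpha> b)) = (\<Sum>\<alpha>\<in>?D. \<Sum>x\<in>deg_less b. of_bool (x \<in> hankel_ker P \<alpha> b))"
    by (intro sum.cong refl) (simp add: finite_deg_less sum_of_bool_eq Int_def hankel_ker_def)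
  also have "\<dots> = (\<Sum>x\<in>deg_less b. card (A x))"
    by (subst sum.swap) (auto intro!: sum.cong simp: finite_deg_less sum_of_bool_eq Int_def hankel_ker_def A_def)
  finally have "?q * (\<Sum>\<alpha>\<in>?D. card (hankel_ker P \<alpha> b)) = (\<Sum>x\<in>deg_less b. ?q * card (A x))"
    by (simp add: sum_distrib_left)
  also have "\<dots> = ?q * card (A 0) + (\<Sum>x\<in>deg_less b - {0}. ?q * card (A x))"
    by (rule sum.remove) (auto simp: finite_deg_less deg_less_iff)
  also have "\<dots> = ?q ^ (2 * P) + (\<Sum>x\<in>deg_less b - {0::'a poly}. ?q ^ b)"
    unfolding A0 by (intro arg_cong2[of _ _ _ _ "(+)"] refl sum.cong A) auto
  also have "\<dots> = ?q ^ (2 * P) + (?q ^ b - 1) * ?q ^ b"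
    by (simp add: finite_deg_less card_Diff_singleton deg_less_iff card_deg_less)
  finally have "int (?q * (\<Sum>\<alpha>\<in>?D. card (hankel_ker P \<alpha> b))) = int (?q ^ (2 * P) + (?q ^ b - 1) * ?q ^ b)"
    by simp
  then show ?thesis by (simp add: of_nat_diff)
qed

section \<open>Distribution of the Hankel nullity\<close>

lemma card_field_gt_1: "CARD('a::{finite,field}) > 1"
  using card_mono[of UNIV "{0, 1::'a}"] by simp

text \<open>Always |K_(b+1)| = q |K_b| - (q - 1) [K_(b+1) = 0], since a trivial K_(b+1) forces a
  trivial K_b. Summing over \<open>\<alpha>\<close> and inserting both averages leaves the number of
  trivial kernels as the only unknown.\<close>

lemma card_hankel_ker_trivial:
  assumes b: "b < P"
  shows "int (card {\<alpha> \<in> deg_less (2 * P - 1) :: 'a::{finite,field} poly set. hankel_ker P \<alpha> (Suc b) = {0}}) =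
    int CARD('a) ^ (2 * P - 1) - int CARD('a) ^ (2 * b)"
proof -
  let ?q = "int CARD('a)" and ?D = "deg_less (2 * P - 1) :: 'a poly set"
  let ?S = "\<lambda>c. \<Sum>\<alpha>\<in>?D. int (card (hankel_ker P \<alpha> c))"
  let ?Z = "{\<alpha> \<in> ?D. hankel_ker P \<alpha> (Suc b) = {0}}"
  have P: "P \<ge> 1" using b by simp
  have "int (card (hankel_ker P \<alpha> (Suc b))) =
      ?q * int (card (hankel_ker P \<alpha> b)) - (?q - 1) * of_bool (hankel_ker P \<alpha> (Suc b) = {0})" for \<alpha> :: "'a poly"
  proof (cases "hankel_ker P \<alpha> (Suc b) = {0}")
    case True
    moreover have "hankel_ker P \<alpha> b = {0}"
      using True hankel_ker_mono[of b "Suc b" P \<alpha>] zero_in_hankel_ker[of P \<alpha> b] by auto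
    ultimately show ?thesis by simp
  next
    case False
    then show ?thesis using card_hankel_ker_Suc[OF b False] by simp
  qed
  then have "?S (Suc b) = ?q * ?S b - (?q - 1) * int (card ?Z)"
    by (simp add: sum_subtractf sum_of_bool_eq finite_deg_less Int_def flip: sum_distrib_left)
  then have "?q * ?S (Suc b) = ?q * (?q * ?S b) - ?q * (?q - 1) * int (card ?Z)"
    by (simp only: ring_distribs mult_ac mult_1_left)
  moreover have "?q * ?S (Suc b) = ?q ^ (2 * P) + (?q ^ Suc b - 1) * ?q ^ Suc b"
    by (rule sum_card_hankel_ker) (use b P in auto)
  moreover have "?q * (?q * ?S b) = ?q * (?q ^ (2 * P) + (?q ^ b - 1) * ?q ^ b)"
    by (subst sum_card_hankel_ker) (use b P in auto)
  moreover have "?q ^ (2 * P) = ?q * ?q ^ (2 * P - 1)"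
    using P by (simp flip: power_Suc)
  moreover have "?q ^ (2 * b) = ?q ^ b * ?q ^ b" by (simp add: mult_2 power_add)
  ultimately have "(?q * (?q - 1)) * int (card ?Z) = (?q * (?q - 1)) * (?q ^ (2 * P - 1) - ?q ^ (2 * b))"
    by (simp add: algebra_simps)
  then show ?thesis using card_field_gt_1[where ?'a = 'a] by simp
qed

text \<open>The dimension of \<open>hankel_ker P \<alpha> b\<close>: each nonzero kernel up to \<open>b\<close> adds one.\<close>

definition hankel_nullity :: "nat \<Rightarrow> 'a::field poly \<Rightarrow> nat \<Rightarrow> nat" where
  "hankel_nullity P \<alpha> b = card {c. c < b \<and> hankel_ker P \<alpha> (Suc c) \<noteq> {0}}"

lemma hankel_nullity_0: "hankel_nullity P \<alpha> 0 = 0"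
  by (simp add: hankel_nullity_def)

lemma hankel_nullity_Suc:
  "hankel_nullity P \<alpha> (Suc b) = (if hankel_ker P \<alpha> (Suc b) = {0} then 0 else Suc (hankel_nullity P \<alpha> b))"
proof (cases "hankel_ker P \<alpha> (Suc b) = {0}")
  case True
  have "hankel_ker P \<alpha> (Suc c) = {0}" if "c < Suc b" for c
    using True that hankel_ker_mono[of "Suc c" "Suc b" P \<alpha>] zero_in_hankel_ker[of P \<alpha> "Suc c"] by auto
  then have "{c. c < Suc b \<and> hankel_ker P \<alpha> (Suc c) \<noteq> {0}} = {}" by auto
  then show ?thesis using True by (simp only: hankel_nullity_def) simp
next
  case False
  then have "{c. c < Suc b \<and> hankel_ker P \<alpha> (Suc c) \<noteq> {0}} =
      insert b {c. c < b \<and> hankel_ker P \<alpha> (Suc c) \<noteq> {0}}"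
    by (auto simp: less_Suc_eq)
  then show ?thesis using False by (simp add: hankel_nullity_def)
qed

lemma card_hankel_ker:
  fixes \<alpha> :: "'a::{finite,field} poly"
  shows "b \<le> P \<Longrightarrow> card (hankel_ker P \<alpha> b) = CARD('a) ^ hankel_nullity P \<alpha> b"
proof (induction b)
  case (Suc b)
  then show ?case using card_hankel_ker_Suc[of b P \<alpha>] by (simp add: hankel_nullity_Suc)
qed (simp add: hankel_ker_0 hankel_nullity_0)

text \<open>The sum obeys a first-order recurrence in \<open>b\<close>, with inhomogeneous term from
  \<open>card_hankel_ker_trivial\<close>. Its solution is a geometric sum, whose denominator q^2 - w
  is kept as a factor on the left.\<close>

lemma sum_power_hankel_nullity:
  fixes w :: int
  shows "b \<le> P \<Longrightarrow> (int CARD('a::{finite,field}) ^ 2 - w) *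
      ((\<Sum>\<alpha>\<in>(deg_less (2 * P - 1) :: 'a poly set). w ^ hankel_nullity P \<alpha> b) - int CARD('a) ^ (2 * P - 1)) =
    (w - 1) * (int CARD('a) ^ (2 * b) - w ^ b)"
proof (induction b)
  case 0
  then show ?case by (simp add: hankel_nullity_0 card_deg_less)
next
  case (Suc b)
  let ?q = "int CARD('a)" and ?D = "deg_less (2 * P - 1) :: 'a poly set"
  let ?T = "\<lambda>c. \<Sum>\<alpha>\<in>?D. w ^ hankel_nullity P \<alpha> c"
  have "w ^ hankel_nullity P \<alpha> (Suc b) =
      w * w ^ hankel_nullity P \<alpha> b - (w - 1) * of_bool (hankel_ker P \<alpha> (Suc b) = {0})" for \<alpha> :: "'a poly"
  proof (cases "hankel_ker P \<alpha> (Suc b) = {0}")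
    case True
    \<comment> \<open>Both nullities are 0 here, and the right-hand side is w - (w - 1).\<close>
    have "hankel_nullity P \<alpha> b \<le> hankel_nullity P \<alpha> (Suc b)"
      unfolding hankel_nullity_def by (rule card_mono) auto
    then show ?thesis using True by (simp add: hankel_nullity_Suc)
  qed (simp add: hankel_nullity_Suc)
  then have "?T (Suc b) = w * ?T b -
      (w - 1) * int (card {\<alpha> \<in> ?D. hankel_ker P \<alpha> (Suc b) = {0}})"
    by (simp add: sum_subtractf sum_of_bool_eq finite_deg_less Int_def flip: sum_distrib_left)
  then have T: "?T (Suc b) = w * ?T b - (w - 1) * (?q ^ (2 * P - 1) - ?q ^ (2 * b))"
    using card_hankel_ker_trivial[of b P, where ?'a = 'a] Suc.prems by simp
  have "(?q ^ 2 - w) * (?T (Suc b) - ?q ^ (2 * P - 1)) =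
      w * ((?q ^ 2 - w) * (?T b - ?q ^ (2 * P - 1))) + (?q ^ 2 - w) * (w - 1) * ?q ^ (2 * b)"
    unfolding T by (simp add: algebra_simps)
  also have "\<dots> = w * ((w - 1) * (?q ^ (2 * b) - w ^ b)) + (?q ^ 2 - w) * (w - 1) * ?q ^ (2 * b)"
    using Suc by simp
  also have "\<dots> = (w - 1) * (?q ^ (2 * Suc b) - w ^ Suc b)"
    by (simp add: algebra_simps power2_eq_square)
  finally show ?case .
qed

section \<open>Counting zeros\<close>

text \<open>The form takes values with at most \<open>2 * P - 1\<close> coefficients. Summing
  \<open>?\<chi>\<close> of such a value over all functionals \<open>\<alpha>\<close> detects its
  vanishing with weight q^(2P-1); in the other order of summation, each \<open>\<alpha>\<close>
  contributes the bias of a tensor form.\<close>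

lemma count_N_eq_sum:
  fixes a :: "nat \<Rightarrow> 'a::{finite,field}"
  assumes odd: "odd CARD('a)" and a: "\<forall>i<2 * m. a i \<noteq> 0" and P: "P \<ge> 1"
    and nonsq: "\<not> is_sq ((-1) ^ m * (\<Prod>i<2 * m. a i))"
  shows "int (count_N (2 * m) a P) * int CARD('a) ^ (2 * P - 1) =
    (\<Sum>\<alpha>\<in>(deg_less (2 * P - 1) :: 'a poly set). (- (int CARD('a) ^ m)) ^ (P + hankel_nullity P \<alpha> P))"
proof -
  let ?q = "int CARD('a)" and ?d = "2 * P - 1" and ?n = "2 * m"
  let ?D = "deg_less ?d :: 'a poly set" and ?X = "vecs ?n (deg_less P) :: (nat \<Rightarrow> 'a poly) set"
  let ?w = "- (?q ^ m)"
  let ?\<chi> = "\<lambda>z. of_bool (z = 0) - of_bool (z = 1) :: int"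
  have pos: "CARD('a) ^ k > 0" for k using card_field_gt_1[where ?'a = 'a] by simp
  have finX: "finite ?X"
    using card_vecs[of ?n "deg_less P :: 'a poly set"] pos by (intro card_ge_0_finite) (simp add: card_deg_less)
  have base: "biased (vecs ?n UNIV) (\<lambda>c. \<Sum>i<?n. a i * c i ^ 2) ?w"
    using biased_even_form[OF odd a] nonsq by simp
  have inner: "(\<Sum>x\<in>?X. ?\<chi> (coeff_pairing ?d \<alpha> (diag_form ?n a x))) = ?w ^ (P + hankel_nullity P \<alpha> P)"
    for \<alpha> :: "'a poly"
  proof -
    let ?B = "\<lambda>x y. coeff_pairing ?d \<alpha> (x * y)"
    define k where "k = hankel_nullity P \<alpha> P"
    \<comment> \<open>At \<open>b = P\<close> both degree bounds in \<open>hankel_ker\<close> are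
      \<open>P\<close>, so this kernel is the radical of the Hankel form.\<close>
    have rad: "card (poly_space.radical ?B (deg_less P)) = CARD('a) ^ k"
      using card_hankel_ker[of P P \<alpha>] by (simp add: poly_space.radical_def hankel_ker_def k_def)
    obtain r where r: "card (deg_less P :: 'a poly set) = CARD('a) ^ r * CARD('a) ^ k"
      "biased ?X (\<lambda>x. \<Sum>i<?n. a i * ?B (x i) (x i)) (?w ^ r * int (CARD('a) ^ k) ^ ?n)"
      using poly_space.biased_tensor_form[OF odd _ _ _ base subspace_deg_less finite_deg_less, of ?B P]
      unfolding rad by (auto simp: mult.commute distrib_left coeff_pairing_add coeff_pairing_smult)
    have "CARD('a) ^ P = CARD('a) ^ (r + k)" using r(1) by (simp add: card_deg_less power_add)
    then have "P = r + k" using card_field_gt_1[where ?'a = 'a] by simp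
    then have "?w ^ (P + k) = ?w ^ r * ?w ^ (2 * k)" by (simp add: power_add mult_2)
    \<comment> \<open>The even exponent removes the sign of \<open>?w\<close>, so the radical
      contributes \<open>2 * k\<close> further factors \<open>?w\<close>; with rank
      \<open>r = P - k\<close> the total exponent is \<open>P + k\<close>.\<close>
    moreover have "int (CARD('a) ^ k) ^ ?n = ?w ^ (2 * k)"
      by (simp add: power_mult[symmetric] mult_ac)
    moreover have "coeff_pairing ?d \<alpha> (diag_form ?n a x) = (\<Sum>i<?n. a i * ?B (x i) (x i))" for x
      by (simp add: diag_form_def coeff_pairing_sum coeff_pairing_smult power2_eq_square)
    ultimately show ?thesis using biasedD[OF r(2) one_neq_zero] by (simp only: k_def)
  qed
  \<comment> \<open>Evaluation at \<open>f\<close> is linear in \<open>\<alpha>\<close>, and by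
    nondegeneracy it vanishes identically only for \<open>f = 0\<close>.\<close>
  have outer: "(\<Sum>\<alpha>\<in>?D. ?\<chi> (coeff_pairing ?d \<alpha> f)) = (if f = 0 then ?q ^ ?d else 0)"
    if "f \<in> ?D" for f
  proof -
    have "biased ?D (coeff_pairing ?d f) (if \<forall>\<alpha>\<in>?D. coeff_pairing ?d f \<alpha> = 0 then int (card ?D) else 0)"
      by (rule poly_space.biased_linear_functional)
        (auto simp: subspace_deg_less finite_deg_less coeff_pairing_add coeff_pairing_smult)
    moreover have "(\<forall>\<alpha>\<in>?D. coeff_pairing ?d f \<alpha> = 0) \<longleftrightarrow> f = 0"
      using coeff_pairing_nondegenerate[of ?d, where ?'a = 'a] that
      by (auto simp: poly_space.radical_def)
    ultimately show ?thesis
      using biasedD[of ?D "coeff_pairing ?d f" _ 1] by (simp add: card_deg_less coeff_pairing_commute[of _ _ f])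
  qed
  have diag: "diag_form ?n a x \<in> ?D" if "x \<in> ?X" for x
    unfolding diag_form_def
  proof (rule poly_space.subspace_sum[OF subspace_deg_less])
    fix i assume "i \<in> {..<?n}"
    then have "x i * x i \<in> ?D" using that P by (intro deg_less_mult[of _ P _ P]) (auto simp: vecs_def)
    then show "smult (a i) ((x i)\<^sup>2) \<in> ?D"
      using poly_space.subspace_scale[OF subspace_deg_less] by (simp add: power2_eq_square)
  qed
  have "count_N ?n a P = card {x \<in> ?X. diag_form ?n a x = 0}"
    unfolding count_N_def vecs_def by (rule arg_cong[of _ _ card]) (auto simp: deg_less_iff)
  then have "int (count_N ?n a P) * ?q ^ ?d = (\<Sum>x\<in>?X. if diag_form ?n a x = 0 then ?q ^ ?d else 0)"
    using finX by (simp add: sum.If_cases Int_def)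
  also have "\<dots> = (\<Sum>x\<in>?X. \<Sum>\<alpha>\<in>?D. ?\<chi> (coeff_pairing ?d \<alpha> (diag_form ?n a x)))"
    by (intro sum.cong refl) (simp only: outer[OF diag])
  also have "\<dots> = (\<Sum>\<alpha>\<in>?D. ?w ^ (P + hankel_nullity P \<alpha> P))"
    by (subst sum.swap) (simp only: inner)
  finally show ?thesis .
qed

text \<open>This is \<open>sum_power_hankel_nullity\<close> at w = -q^m, with all denominators
  cleared so that the computation stays in the integers until the final cast.\<close>

lemma count_N_formula:
  fixes a :: "nat \<Rightarrow> 'a::{finite,field}"
  assumes "odd CARD('a)" "\<forall>i<2 * m. a i \<noteq> 0" "P \<ge> 1"
    and "\<not> is_sq ((-1) ^ m * (\<Prod>i<2 * m. a i))"
  defines "q \<equiv> real CARD('a)"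
  shows "real (count_N (2 * m) a P) * q ^ (2 * P) * (q ^ 2 + q ^ m) =
    q * (-1) ^ P * q ^ (m * P) *
      (q ^ (2 * P - 1) * (q ^ 2 + q ^ m) - (q ^ m + 1) * (q ^ (2 * P) - (-1) ^ P * q ^ (m * P)))"
proof -
  let ?q = "int CARD('a)" let ?w = "- (?q ^ m)"
  let ?S = "\<Sum>\<alpha>\<in>(deg_less (2 * P - 1) :: 'a poly set). ?w ^ hankel_nullity P \<alpha> P"
  have N: "int (count_N (2 * m) a P) * ?q ^ (2 * P - 1) = ?w ^ P * ?S"
    using count_N_eq_sum[OF assms(1-4)] by (simp add: power_add sum_distrib_left)
  have S: "(?q ^ 2 - ?w) * (?S - ?q ^ (2 * P - 1)) = (?w - 1) * (?q ^ (2 * P) - ?w ^ P)"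
    by (rule sum_power_hankel_nullity) simp
  have w: "?w ^ P = (-1) ^ P * ?q ^ (m * P)"
    by (simp add: power_minus[of "?q ^ m"] flip: power_mult)
  have "?q ^ (2 * P) = ?q * ?q ^ (2 * P - 1)" using assms(3) by (simp flip: power_Suc)
  then have "int (count_N (2 * m) a P) * ?q ^ (2 * P) * (?q ^ 2 - ?w) =
      ?q * (int (count_N (2 * m) a P) * ?q ^ (2 * P - 1)) * (?q ^ 2 - ?w)"
    by (simp add: algebra_simps)
  also have "\<dots> = ?q * ?w ^ P * ((?q ^ 2 - ?w) * ?S)" unfolding N by (simp only: mult_ac)
  also have "(?q ^ 2 - ?w) * ?S = ?q ^ (2 * P - 1) * (?q ^ 2 - ?w) + (?w - 1) * (?q ^ (2 * P) - ?w ^ P)"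
    using S by (simp add: algebra_simps)
  finally have "int (count_N (2 * m) a P) * ?q ^ (2 * P) * (?q ^ 2 + ?q ^ m) =
    ?q * (-1) ^ P * ?q ^ (m * P) * (?q ^ (2 * P - 1) * (?q ^ 2 + ?q ^ m) -
      (?q ^ m + 1) * (?q ^ (2 * P) - (-1) ^ P * ?q ^ (m * P)))"
    unfolding w by (simp add: algebra_simps)
  from arg_cong[OF this, of real_of_int] show ?thesis unfolding q_def by simp
qed

theorem theorem5p6:
  fixes a :: "nat \<Rightarrow> 'a::{finite,field}" and n P :: nat
  assumes q_odd: "odd CARD('a)"
    and n_even: "even n" and n_ge: "n \<ge> 4"
    and a_nz: "\<forall>i<n. a i \<noteq> 0"
    and nonsq: "\<not> (\<exists>y::'a. y ^ 2 = (-1) ^ (n div 2) * (\<Prod>i<n. a i))"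
    and P_ge: "P \<ge> 1"
  shows "(n = 4 \<longrightarrow>
            real (count_N n a P) =
              (if even P then real CARD('a) ^ (2 * P)
               else (real CARD('a) ^ 2 - real CARD('a) + 1) / real CARD('a)
                    * real CARD('a) ^ (2 * P))) \<and>
         (n \<ge> 6 \<longrightarrow>
            real (count_N n a P) =
              (real CARD('a) ^ (n div 2) + 1) / (real CARD('a) ^ (n div 2 - 1) + real CARD('a))
                * real CARD('a) ^ (P * (n - 2))
              - (-1) ^ P * (real CARD('a) - 1)
                * ((real CARD('a) ^ (n div 2 - 1) - 1) / (real CARD('a) ^ (n div 2 - 1) + real CARD('a)))
                * real CARD('a) ^ ((n div 2) * P))"
proof -
  obtain m where m: "n = 2 * m" using n_even by (elim evenE)
  define q N where "q = real CARD('a)" and "N = real (count_N n a P)"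
  have q: "q > 1" using card_field_gt_1[where ?'a = 'a] by (simp add: q_def)
  have A: "N * q ^ (2 * P) * (q ^ 2 + q ^ m) =
    q * (-1) ^ P * q ^ (m * P) *
      (q ^ (2 * P - 1) * (q ^ 2 + q ^ m) - (q ^ m + 1) * (q ^ (2 * P) - (-1) ^ P * q ^ (m * P)))"
    unfolding N_def q_def m
    by (rule count_N_formula) (use assms m in \<open>auto simp: is_sq_def\<close>)
  \<comment> \<open>Here \<open>s\<close> is the power in the denominators of the claim, and
    \<open>v\<close> below is the P-th power of the bias -q^m. In these terms \<open>A\<close> is a
    polynomial identity.\<close>
  define s u where "s = q ^ (m - 1)" and "u = q ^ (2 * P)"
  define v :: real where "v = (-1) ^ P * q ^ (m * P)"
  have qm: "q ^ m = q * s" using m n_ge by (simp add: s_def flip: power_Suc)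
  have u: "q * q ^ (2 * P - 1) = u" using P_ge by (simp add: u_def flip: power_Suc)
  have pos: "s > 0" "u > 0" using q by (simp_all add: s_def u_def)
  have "N * u * (q * (q + s)) =
      v * ((q * q ^ (2 * P - 1)) * (q * (q + s)) - q * (q * s + 1) * (u - v))"
    using A unfolding qm v_def u_def by (simp add: algebra_simps power2_eq_square)
  then have "q * (N * u * (q + s)) = q * (v * (u * (q + s) - (q * s + 1) * (u - v)))"
    unfolding u by (simp only: mult_ac right_diff_distrib)
  then have B: "N * u * (q + s) = v * (u * (q + s) - (q * s + 1) * (u - v))" using q by simp
  \<comment> \<open>This relation makes the right-hand side of \<open>B\<close> a multiple of
    \<open>u\<close>, which then cancels.\<close>
  have vv: "v * v = u * q ^ (P * (n - 2))"
  proof -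
    have "v * v = ((-1) ^ P * (-1) ^ P) * (q ^ (m * P) * q ^ (m * P))"
      by (simp only: v_def mult_ac)
    also have "\<dots> = q ^ (m * P + m * P)" by (simp add: power_add flip: power_mult_distrib[of "-1" "-1"])
    also have "m * P + m * P = 2 * P + P * (n - 2)"
      using m n_ge by (simp add: algebra_simps flip: mult_2)
    finally show ?thesis by (simp add: u_def power_add)
  qed
  have "u * (N * (s + q)) = (q * s + 1) * (v * v) - u * (v * ((q - 1) * (s - 1)))"
    using B by (simp add: algebra_simps)
  also have "\<dots> = u * ((q * s + 1) * q ^ (P * (n - 2)) - v * ((q - 1) * (s - 1)))"
    unfolding vv by (simp add: algebra_simps)
  finally have C: "N * (s + q) = (q * s + 1) * q ^ (P * (n - 2)) - v * ((q - 1) * (s - 1))"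
    using pos by simp
  have sq: "s + q > 0" using pos q by simp
  have gen: "N = (q ^ m + 1) / (s + q) * q ^ (P * (n - 2)) - (-1) ^ P * (q - 1) * ((s - 1) / (s + q)) * q ^ (m * P)"
  proof -
    have "N = ((q * s + 1) * q ^ (P * (n - 2)) - v * ((q - 1) * (s - 1))) / (s + q)"
      using C sq by (simp add: eq_divide_eq)
    then show ?thesis by (simp add: v_def qm algebra_simps add_divide_distrib diff_divide_distrib)
  qed
  \<comment> \<open>For \<open>n = 4\<close> both terms have the same order of magnitude, and the
    parity of \<open>P\<close> decides: q^2 + 1 - (q - 1)^2 = 2q, while q^2 + 1 + (q - 1)^2 = 2 (q^2
    - q + 1).\<close>
  have four: "N = (if even P then q ^ (2 * P) else (q ^ 2 - q + 1) / q * q ^ (2 * P))" if "n = 4"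
  proof -
    have "m = 2" using m that by simp
    then have "s = q" "v = (-1) ^ P * u" "q ^ (P * (n - 2)) = u"
      by (simp_all add: s_def v_def u_def that mult.commute)
    then have "N * (q + q) = (q * q + 1) * u - (-1) ^ P * u * ((q - 1) * (q - 1))"
      using C by simp
    then show ?thesis unfolding u_def[symmetric] using q
      by (auto simp: field_simps power2_eq_square)
  qed
  show ?thesis
    using gen four unfolding N_def q_def s_def m by simp
qed

end
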